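(* Let $(T,\Sigma,\mu)$ be a complete $\sigma$-finite measure space, let $1\le p,r\le\infty$ with at least one of $p,r$ finite, let $Y,Z$ be separable Banach spaces, let $S:T\rightrightarrows Y\times Z$ be a measurable multifunction with nonempty closed values, and let $(x,y)\in \mathsf{Sel}_{p,r}(S)$. Let $D:T\rightrightarrows Y\times Z$ be a measurable multifunction with nonempty closed values such that (a) for a.e. $t\in T$, $D(t)$ is a uniform tangent set to $S(t)$ at $(x(t),y(t))$; (b) there is an equi-integrable family $R\subset L^p(T,Y)\times L^r(T,Z)$ such that $\mathsf{Sel}_{p,r}(S)$ is $R$-correctable along $\mathsf{Sel}_{p,r}(D)$ at $(x,y)$. Then $\mathsf{Sel}_{p,r}(D)$ is a uniform tangent set to $\mathsf{Sel}_{p,r}(S)$ at $(x,y)$.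
   Context: $L^p(T,Y)$, $L^r(T,Z)$ are Lebesgue--Bochner spaces; $Y\times Z$ carries the norm $\|\cdot\|_Y+\|\cdot\|_Z$ and $L^p(T,Y)\times L^r(T,Z)$ the norm $\|\cdot\|_{L^p}+\|\cdot\|_{L^r}$. A multifunction with nonempty closed values in a separable Banach space $W$ is measurable if $\{t: S(t)\cap U\ne\emptyset\}\in\Sigma$ for every open $U\subset W$. For $S:T\rightrightarrows Y\times Z$, $$\mathsf{Sel}_{p,r}(S):=\{(a,b)\in L^p(T,Y)\times L^r(T,Z): (a(t),b(t))\in S(t)\text{ a.e.}\}.$$ Below $X$ is a Banach space with closed unit ball $\overline{\mathbf B}_X$. Uniform tangent set: for $C\subset X$ closed and $x\in C$, a set $D\subset X$ is a uniform tangent set to $C$ at $x$ if for every $\varepsilon>0$ there exist $\delta>0$, $\lambda>0$ such that $C\cap[y+\eta(v+\varepsilon\overline{\mathbf B}_X)]\neq\emptyset$ for every $v\in D$, every $y\in C\cap(x+\delta\overline{\mathbf B}_X)$ and every $\eta\in[0,\lambda]$. Correctability: for subsets $H,V,R\subset X$ and $x_0\in H$, $H$ is $R$-correctable along $V$ at $x_0$ if there exist $\delta,\lambda>0$ such that $\big(H\cap(x_0+\delta\overline{\mathbf B}_X)\big)+\eta V\subset H-\eta R$ for all $\eta\in[0,\lambda]$. Equi-integrability: $R\subset L^p(T,Y)\times L^r(T,Z)$ is equi-integrable if for every decreasing sequence of measurable sets $A_n\searrow\emptyset$ (up to null sets), $\sup_{z\in R}\|\mathbf 1_{A_n}z\|_{L^p\times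 L^r}\to0$ as $n\to\infty$. *)

theory Defs
  imports
    "HOL-Analysis.Analysis"
    "HOL-Probability.Essential_Supremum"
    "HOL-Library.Function_Algebras"
begin

instantiation "fun" :: (type, real_vector) real_vector
begin

definition "scaleR c f = (\<lambda>t. c *\<^sub>R f t)"

instance
  by standard (simp_all add: scaleR_fun_def fun_eq_iff scaleR_add_right scaleR_add_left)

end

lemma scaleR_fun_apply [simp]: "(c *\<^sub>R f) t = c *\<^sub>R f t"
  by (simp add: scaleR_fun_def)

text \<open>
  Lebesgue--Bochner spaces depend on a measure and an exponent, so they are not types. A normed
  space is therefore given by a linear subspace \<open>X\<close> of a real vector space together with a
  (semi)norm \<open>N\<close> on \<open>X\<close>. For \<open>Y \<times> Z\<close> one has \<open>X = UNIV\<close>; for Lebesgue--Bochner spaces, \<open>X\<close>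
  consists of representatives and \<open>N\<close> is the corresponding seminorm.
\<close>

definition unit_cball :: "'a::real_vector set \<Rightarrow> ('a \<Rightarrow> real) \<Rightarrow> 'a set" where
  "unit_cball X N = {b \<in> X. N b \<le> 1}"

definition norm_closed :: "'a::real_vector set \<Rightarrow> ('a \<Rightarrow> real) \<Rightarrow> 'a set \<Rightarrow> bool" where
  "norm_closed X N C \<longleftrightarrow>
     C \<subseteq> X \<and> (\<forall>z\<in>X. (\<forall>e>0. \<exists>c\<in>C. N (z - c) < e) \<longrightarrow> z \<in> C)"

definition uniform_tangent_set ::
    "'a::real_vector set \<Rightarrow> ('a \<Rightarrow> real) \<Rightarrow> 'a set \<Rightarrow> 'a \<Rightarrow> 'a set \<Rightarrow> bool" where
  "uniform_tangent_set X N C x D \<longleftrightarrow>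
     norm_closed X N C \<and> x \<in> C \<and> D \<subseteq> X \<and>
     (\<forall>\<epsilon>>0. \<exists>\<delta>>0. \<exists>\<tau>>0.
        \<forall>v\<in>D. \<forall>y\<in>C \<inter> (\<lambda>b. x + \<delta> *\<^sub>R b) ` unit_cball X N. \<forall>\<eta>\<in>{0..\<tau>}.
          C \<inter> (\<lambda>b. y + \<eta> *\<^sub>R (v + \<epsilon> *\<^sub>R b)) ` unit_cball X N \<noteq> {})"

text \<open>\<open>correctable_along X N H V R x0\<close>: \<open>H\<close> is \<open>R\<close>-correctable along \<open>V\<close> at \<open>x0\<close>.\<close>

definition correctable_along ::
    "'a::real_vector set \<Rightarrow> ('a \<Rightarrow> real) \<Rightarrow> 'a set \<Rightarrow> 'a set \<Rightarrow> 'a set \<Rightarrow> 'a \<Rightarrow> bool" where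
  "correctable_along X N H V R x0 \<longleftrightarrow>
     H \<subseteq> X \<and> V \<subseteq> X \<and> R \<subseteq> X \<and> x0 \<in> H \<and>
     (\<exists>\<delta>>0. \<exists>\<tau>>0. \<forall>\<eta>\<in>{0..\<tau>}.
        {h + \<eta> *\<^sub>R v | h v. h \<in> H \<inter> (\<lambda>b. x0 + \<delta> *\<^sub>R b) ` unit_cball X N \<and> v \<in> V}
          \<subseteq> {h - \<eta> *\<^sub>R w | h w. h \<in> H \<and> w \<in> R})"

text \<open>The library norm on a product type is the Euclidean combination; here it is the sum.\<close>

definition sum_norm :: "'y::real_normed_vector \<times> 'z::real_normed_vector \<Rightarrow> real" where
  "sum_norm = (\<lambda>(a, b). norm a + norm b)"

text \<open>The \<open>L\<^sup>p\<close> norm as an extended real; the exponent ranges over \<open>[1, \<infinity>]\<close>.\<close>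

definition Lp_enorm ::
    "'t measure \<Rightarrow> ennreal \<Rightarrow> ('t \<Rightarrow> 'y::real_normed_vector) \<Rightarrow> ennreal" where
  "Lp_enorm M p f =
     (if p = \<infinity> then esssup M (\<lambda>t. ennreal (norm (f t)))
      else let I = (\<integral>\<^sup>+ t. ennreal (norm (f t) powr enn2real p) \<partial>M)
           in if I = \<infinity> then \<infinity> else ennreal (enn2real I powr (1 / enn2real p)))"

text \<open>
  Elements of \<open>L\<^sup>p\<close> are represented by functions rather than by classes modulo equality almost
  everywhere, as usual in the library. For separable \<open>Y\<close> strong and Borel measurability agree.
  The selection sets below are closed under modification on null sets.
\<close>

definition Lp_space ::
    "'t measure \<Rightarrow> ennreal \<Rightarrow> ('t \<Rightarrow> 'y::{banach, second_countable_topology}) set" where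
  "Lp_space M p = {f \<in> borel_measurable M. Lp_enorm M p f < \<infinity>}"

definition Lp_norm :: "'t measure \<Rightarrow> ennreal \<Rightarrow> ('t \<Rightarrow> 'y::real_normed_vector) \<Rightarrow> real" where
  "Lp_norm M p f = enn2real (Lp_enorm M p f)"

definition LpLr_space ::
    "'t measure \<Rightarrow> ennreal \<Rightarrow> ennreal \<Rightarrow>
     (('t \<Rightarrow> 'y::{banach, second_countable_topology}) \<times>
      ('t \<Rightarrow> 'z::{banach, second_countable_topology})) set" where
  "LpLr_space M p r = Lp_space M p \<times> Lp_space M r"

definition LpLr_norm ::
    "'t measure \<Rightarrow> ennreal \<Rightarrow> ennreal \<Rightarrow>
     ('t \<Rightarrow> 'y::real_normed_vector) \<times> ('t \<Rightarrow> 'z::real_normed_vector) \<Rightarrow> real" where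
  "LpLr_norm M p r = (\<lambda>(a, b). Lp_norm M p a + Lp_norm M r b)"

definition measurable_closed_multifunction ::
    "'t measure \<Rightarrow> ('t \<Rightarrow> 'w::topological_space set) \<Rightarrow> bool" where
  "measurable_closed_multifunction M S \<longleftrightarrow>
     (\<forall>t\<in>space M. S t \<noteq> {} \<and> closed (S t)) \<and>
     (\<forall>U. open U \<longrightarrow> {t \<in> space M. S t \<inter> U \<noteq> {}} \<in> sets M)"

definition Sel ::
    "'t measure \<Rightarrow> ennreal \<Rightarrow> ennreal \<Rightarrow>
     ('t \<Rightarrow> ('y::{banach, second_countable_topology} \<times>
             'z::{banach, second_countable_topology}) set) \<Rightarrow>
     (('t \<Rightarrow> 'y) \<times> ('t \<Rightarrow> 'z)) set" where
  "Sel M p r S = {(a, b) \<in> LpLr_space M p r. AE t in M. (a t, b t) \<in> S t}"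

text \<open>The supremum is taken in \<open>[0, \<infinity>]\<close>, so it is \<open>0\<close> for the empty family.\<close>

definition equi_integrable ::
    "'t measure \<Rightarrow> ennreal \<Rightarrow> ennreal \<Rightarrow>
     (('t \<Rightarrow> 'y::{banach, second_countable_topology}) \<times>
      ('t \<Rightarrow> 'z::{banach, second_countable_topology})) set \<Rightarrow> bool" where
  "equi_integrable M p r R \<longleftrightarrow>
     R \<subseteq> LpLr_space M p r \<and>
     (\<forall>A :: nat \<Rightarrow> 't set.
        range A \<subseteq> sets M \<and> decseq A \<and> (\<Inter>n. A n) \<in> null_sets M \<longrightarrow>
        (\<lambda>n. SUP (a, b)\<in>R.
           ennreal (LpLr_norm M p r
             (\<lambda>t. indicator (A n) t *\<^sub>R a t, \<lambda>t. indicator (A n) t *\<^sub>R b t))) \<longlonglongrightarrow> 0)"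

end

theory Submission
  imports Defs
begin

text \<open>
  Suppose the tangency fails for some \<open>\<epsilon>\<close>. With \<open>\<delta> = \<tau>\<close> of order \<open>2\<^sup>-\<^sup>n\<close> this yields selections
  \<open>u\<^sub>n\<close> of \<open>S\<close> converging to \<open>(x, y)\<close> in norm, and by the geometric rate also almost everywhere,
  together with selections \<open>v\<^sub>n\<close> of \<open>D\<close> and steps \<open>\<eta>\<^sub>n \<longrightarrow> 0\<close>. Fix a positive weight \<open>\<gamma>\<close> that is
  small in every \<open>L\<^sup>q\<close>, and let \<open>B\<^sub>n\<close> be the set of \<open>t\<close> where \<open>u\<^sub>n(t) + \<eta>\<^sub>n v\<^sub>n(t)\<close> is at distance at
  least \<open>\<eta>\<^sub>n \<gamma>(t)\<close> from \<open>S(t)\<close>. Pointwise tangency says that almost every \<open>t\<close> lies in only finitely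
  many \<open>B\<^sub>n\<close>, so the sets \<open>A\<^sub>n = \<Union>m\<ge>n. B\<^sub>m\<close> decrease to a null set and the corrections from \<open>R\<close> are
  uniformly small on \<open>A\<^sub>n\<close>. Gluing the corrected selection on \<open>B\<^sub>n\<close> with a measurable nearly
  nearest-point selection of \<open>S\<close> off \<open>B\<^sub>n\<close> gives a selection within \<open>\<eta>\<^sub>n \<epsilon>\<close> of \<open>u\<^sub>n + \<eta>\<^sub>n v\<^sub>n\<close>, a
  contradiction. Defining \<open>B\<^sub>n\<close> by the distance to \<open>S(t)\<close> avoids a measurable choice of the
  pointwise radii \<open>\<delta>(t)\<close> and \<open>\<tau>(t)\<close>.
\<close>

section \<open>Lebesgue--Bochner spaces\<close>

lemma one_le_enn2real:
  assumes "1 \<le> p" "p < \<infinity>"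
  shows "1 \<le> enn2real p"
  using assms enn2real_mono[of 1 p] by (simp add: top.not_eq_extremum)

text \<open>The maps \<open>x powr q\<close> and \<open>x powr (1 / q)\<close> are monotone and
  mutually inverse on nonnegative reals, and an infinite integral falsifies both sides. Norm
  estimates with a finite exponent thereby reduce to estimates of integrals.\<close>

lemma Lp_enorm_le_iff:
  assumes "1 \<le> p" "p < \<infinity>" "0 \<le> c"
  shows "Lp_enorm M p f \<le> ennreal c \<longleftrightarrow>
    (\<integral>\<^sup>+ t. ennreal (norm (f t) powr enn2real p) \<partial>M) \<le> ennreal (c powr enn2real p)"
proof -
  define q where "q = enn2real p"
  define I where "I = (\<integral>\<^sup>+ t. ennreal (norm (f t) powr q) \<partial>M)"
  have q: "q \<ge> 1"
    using one_le_enn2real[OF assms(1,2)] by (simp add: q_def)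
  have eq: "Lp_enorm M p f = (if I = \<infinity> then \<infinity> else ennreal (enn2real I powr (1 / q)))"
    using less_imp_neq[OF assms(2)] by (simp add: Lp_enorm_def I_def q_def Let_def)
  have "Lp_enorm M p f \<le> ennreal c \<longleftrightarrow> I \<le> ennreal (c powr q)"
  proof (cases "I = \<infinity>")
    case True
    then show ?thesis by (simp add: eq top_unique)
  next
    case False
    then obtain i where i: "I = ennreal i" "0 \<le> i"
      by (cases I) auto
    have "i powr (1 / q) \<le> c \<longleftrightarrow> i \<le> c powr q"
    proof
      assume "i powr (1 / q) \<le> c"
      then have "(i powr (1 / q)) powr q \<le> c powr q"
        using q by (intro powr_mono2) auto
      then show "i \<le> c powr q" using q i by (simp add: powr_powr)
    next
      assume "i \<le> c powr q"
      then have "i powr (1 / q) \<le> (c powr q) powr (1 / q)"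
        using q i by (intro powr_mono2) auto
      then show "i powr (1 / q) \<le> c" using q assms(3) by (simp add: powr_powr)
    qed
    then show ?thesis using i assms(3) by (simp add: eq)
  qed
  then show ?thesis by (simp add: I_def q_def)
qed

text \<open>The essential supremum is an almost everywhere bound, and the least one; this is the
  counterpart of \<open>Lp_enorm_le_iff\<close> for the infinite exponent.\<close>

lemma Lp_enorm_infinity_le_iff:
  assumes [measurable]: "f \<in> borel_measurable M" and "0 \<le> c"
  shows "Lp_enorm M \<infinity> f \<le> ennreal c \<longleftrightarrow> (AE t in M. norm (f t) \<le> c)"
proof
  assume a: "Lp_enorm M \<infinity> f \<le> ennreal c"
  have "AE t in M. ennreal (norm (f t)) \<le> Lp_enorm M \<infinity> f"
    by (simp add: Lp_enorm_def esssup_AE)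
  then show "AE t in M. norm (f t) \<le> c"
    by eventually_elim (use a assms(2) in \<open>metis ennreal_le_iff order_trans\<close>)
next
  assume "AE t in M. norm (f t) \<le> c"
  then show "Lp_enorm M \<infinity> f \<le> ennreal c"
    unfolding Lp_enorm_def by (auto intro!: esssup_I ennreal_leI)
qed

text \<open>The constant 4 avoids convexity: it comes from
  \<open>(a + b)\<^sup>q \<le> 2\<^sup>q (a\<^sup>q + b\<^sup>q)\<close> and \<open>2 \<cdot> 2\<^sup>q \<le> 4\<^sup>q\<close>.\<close>

lemma Lp_enorm_le_sum:
  assumes p: "1 \<le> p" and c: "0 \<le> c"
    and [measurable]: "h \<in> borel_measurable M" "f \<in> borel_measurable M" "g \<in> borel_measurable M"
    and le: "AE t in M. norm (h t) \<le> norm (f t) + norm (g t)"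
    and f: "Lp_enorm M p f \<le> ennreal c" and g: "Lp_enorm M p g \<le> ennreal c"
  shows "Lp_enorm M p h \<le> ennreal (4 * c)"
proof (cases "p = \<infinity>")
  case True
  have "AE t in M. norm (f t) \<le> c" "AE t in M. norm (g t) \<le> c"
    using f g c Lp_enorm_infinity_le_iff[of f M c] Lp_enorm_infinity_le_iff[of g M c]
    by (auto simp: True)
  with le have "AE t in M. norm (h t) \<le> 4 * c"
    by eventually_elim (use c in linarith)
  then show ?thesis
    using c Lp_enorm_infinity_le_iff[of h M "4 * c"] by (simp add: True)
next
  case False
  then have p': "p < \<infinity>" by (simp add: top.not_eq_extremum)
  define q where "q = enn2real p"
  have q: "q \<ge> 1"
    using one_le_enn2real[OF p p'] by (simp add: q_def)
  have pw: "z powr q \<le> 2 powr q * (x powr q + y powr q)"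
    if "0 \<le> x" "0 \<le> y" "0 \<le> z" "z \<le> x + y" for x y z :: real
  proof -
    have "z powr q \<le> (2 * max x y) powr q"
      using that q by (intro powr_mono2) auto
    also have "\<dots> = 2 powr q * max x y powr q"
      using that by (simp add: powr_mult)
    also have "\<dots> \<le> 2 powr q * (x powr q + y powr q)"
      by (intro mult_left_mono) (auto simp: max_def)
    finally show ?thesis .
  qed
  have f': "(\<integral>\<^sup>+ t. ennreal (norm (f t) powr q) \<partial>M) \<le> ennreal (c powr q)"
    and g': "(\<integral>\<^sup>+ t. ennreal (norm (g t) powr q) \<partial>M) \<le> ennreal (c powr q)"
    using f g Lp_enorm_le_iff[OF p p' c] by (auto simp: q_def)
  have "(\<integral>\<^sup>+ t. ennreal (norm (h t) powr q) \<partial>M)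
      \<le> (\<integral>\<^sup>+ t. ennreal (2 powr q) *
            (ennreal (norm (f t) powr q) + ennreal (norm (g t) powr q)) \<partial>M)"
  proof (rule nn_integral_mono_AE)
    show "AE t in M. ennreal (norm (h t) powr q) \<le> ennreal (2 powr q) *
            (ennreal (norm (f t) powr q) + ennreal (norm (g t) powr q))"
      using le
      by eventually_elim
        (use pw in \<open>simp add: ennreal_mult'[symmetric] ennreal_plus[symmetric] del: ennreal_plus\<close>)
  qed
  also have "\<dots> = ennreal (2 powr q) * ((\<integral>\<^sup>+ t. ennreal (norm (f t) powr q) \<partial>M)
      + (\<integral>\<^sup>+ t. ennreal (norm (g t) powr q) \<partial>M))"
    by (simp add: nn_integral_cmult nn_integral_add)
  also have "\<dots> \<le> ennreal (2 powr q) * (ennreal (c powr q) + ennreal (c powr q))"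
    by (intro mult_left_mono add_mono f' g') auto
  also have "\<dots> = ennreal (2 * 2 powr q * c powr q)"
    by (simp add: ennreal_mult'[symmetric] ennreal_plus[symmetric] del: ennreal_plus)
  also have "\<dots> \<le> ennreal ((4 * c) powr q)"
  proof (rule ennreal_leI)
    have "(2::real) powr 1 * 2 powr q \<le> 2 powr q * 2 powr q"
      using q by (intro mult_right_mono powr_mono) auto
    also have "\<dots> = 4 powr q"
      by (simp flip: powr_mult)
    finally show "2 * 2 powr q * c powr q \<le> (4 * c) powr q"
      using c by (simp add: powr_mult mult_right_mono)
  qed
  finally show ?thesis
    using Lp_enorm_le_iff[OF p p', of "4 * c" M h] c by (simp add: q_def)
qed

lemma Lp_enorm_mono:
  assumes [measurable]: "f \<in> borel_measurable M"
    and p: "1 \<le> p" and c: "0 \<le> c" and [measurable]: "h \<in> borel_measurable M"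
    and le: "AE t in M. norm (h t) \<le> norm (f t)" and f: "Lp_enorm M p f \<le> ennreal c"
  shows "Lp_enorm M p h \<le> ennreal c"
proof (cases "p = \<infinity>")
  case True
  have "AE t in M. norm (f t) \<le> c"
    using f c Lp_enorm_infinity_le_iff[of f M c] by (auto simp: True)
  with le have "AE t in M. norm (h t) \<le> c"
    by eventually_elim linarith
  then show ?thesis
    using c Lp_enorm_infinity_le_iff[of h M c] by (simp add: True)
next
  case False
  then have p': "p < \<infinity>" by (simp add: top.not_eq_extremum)
  have "(\<integral>\<^sup>+ t. ennreal (norm (h t) powr enn2real p) \<partial>M)
      \<le> (\<integral>\<^sup>+ t. ennreal (norm (f t) powr enn2real p) \<partial>M)"
  proof (rule nn_integral_mono_AE)
    show "AE t in M. ennreal (norm (h t) powr enn2real p) \<le> ennreal (norm (f t) powr enn2real p)"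
      using le by eventually_elim (auto intro!: ennreal_leI powr_mono2)
  qed
  then show ?thesis
    using f Lp_enorm_le_iff[OF p p' c, of M f] Lp_enorm_le_iff[OF p p' c, of M h] by simp
qed

lemma Lp_enorm_scaleR:
  assumes [measurable]: "f \<in> borel_measurable M"
    and p: "1 \<le> p" and c: "0 \<le> c" and f: "Lp_enorm M p f \<le> ennreal c"
  shows "Lp_enorm M p (\<lambda>t. k *\<^sub>R f t) \<le> ennreal (\<bar>k\<bar> * c)"
proof (cases "p = \<infinity>")
  case True
  have "AE t in M. norm (f t) \<le> c"
    using f c Lp_enorm_infinity_le_iff[of f M c] by (auto simp: True)
  then have "AE t in M. norm (k *\<^sub>R f t) \<le> \<bar>k\<bar> * c"
    by eventually_elim (simp add: mult_left_mono)
  then show ?thesis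
    using c Lp_enorm_infinity_le_iff[of "\<lambda>t. k *\<^sub>R f t" M "\<bar>k\<bar> * c"] by (simp add: True)
next
  case False
  then have p': "p < \<infinity>" by (simp add: top.not_eq_extremum)
  define q where "q = enn2real p"
  have "(\<integral>\<^sup>+ t. ennreal (norm (k *\<^sub>R f t) powr q) \<partial>M)
      = ennreal (\<bar>k\<bar> powr q) * (\<integral>\<^sup>+ t. ennreal (norm (f t) powr q) \<partial>M)"
    by (simp add: powr_mult ennreal_mult' nn_integral_cmult)
  also have "\<dots> \<le> ennreal (\<bar>k\<bar> powr q) * ennreal (c powr q)"
    using f Lp_enorm_le_iff[OF p p' c, of M f] by (intro mult_left_mono) (auto simp: q_def)
  also have "\<dots> = ennreal ((\<bar>k\<bar> * c) powr q)"
    using c by (simp add: powr_mult ennreal_mult')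
  finally show ?thesis
    using Lp_enorm_le_iff[OF p p', of "\<bar>k\<bar> * c" M "\<lambda>t. k *\<^sub>R f t"] c by (simp add: q_def)
qed

section \<open>Linear structure of the function spaces and the real-valued norm\<close>

lemma Lp_space_bound:
  assumes "f \<in> Lp_space M p"
  obtains c where "0 \<le> c" "Lp_enorm M p f \<le> ennreal c"
  using assms by (metis (no_types, lifting) Lp_space_def mem_Collect_eq infinity_ennreal_def
      ennreal_enn2real order_refl enn2real_nonneg)

lemma Lp_spaceI:
  "f \<in> borel_measurable M \<Longrightarrow> Lp_enorm M p f \<le> ennreal c \<Longrightarrow> f \<in> Lp_space M p"
  by (auto simp: Lp_space_def intro: le_less_trans)

lemma Lp_space_measurable: "f \<in> Lp_space M p \<Longrightarrow> f \<in> borel_measurable M"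
  by (simp add: Lp_space_def)

lemma Lp_space_scaleR:
  assumes p: "1 \<le> p" and f: "f \<in> Lp_space M p"
  shows "(\<lambda>t. k *\<^sub>R f t) \<in> Lp_space M p"
proof -
  note [measurable] = Lp_space_measurable[OF f]
  obtain c where c: "0 \<le> c" "Lp_enorm M p f \<le> ennreal c"
    using Lp_space_bound[OF f] .
  show ?thesis
    by (rule Lp_spaceI[OF _ Lp_enorm_scaleR[OF _ p c]]) measurable
qed

lemma Lp_space_add:
  assumes p: "1 \<le> p" and f: "f \<in> Lp_space M p" and g: "g \<in> Lp_space M p"
  shows "(\<lambda>t. f t + g t) \<in> Lp_space M p"
proof -
  note [measurable] = Lp_space_measurable[OF f] Lp_space_measurable[OF g]
  obtain c d where c: "0 \<le> c" "Lp_enorm M p f \<le> ennreal c"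
    and d: "0 \<le> d" "Lp_enorm M p g \<le> ennreal d"
    using Lp_space_bound[OF f] Lp_space_bound[OF g] by metis
  \<comment> \<open>\<open>Lp_enorm_le_sum\<close> takes one bound for both summands, hence the
    maximum.\<close>
  have "Lp_enorm M p f \<le> ennreal (max c d)" "Lp_enorm M p g \<le> ennreal (max c d)"
    using c d by (auto intro: order_trans[OF _ ennreal_leI])
  then have "Lp_enorm M p (\<lambda>t. f t + g t) \<le> ennreal (4 * max c d)"
    using p c by (intro Lp_enorm_le_sum[where f=f and g=g]) (auto simp: norm_triangle_ineq)
  then show ?thesis
    by (intro Lp_spaceI) auto
qed

lemma Lp_space_diff:
  assumes "1 \<le> p" "f \<in> Lp_space M p" "g \<in> Lp_space M p"
  shows "(\<lambda>t. f t - g t) \<in> Lp_space M p"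
  using Lp_space_add[OF assms(1,2) Lp_space_scaleR[OF assms(1,3), of "-1"]] by simp

text \<open>\<open>enn2real\<close> sends infinity to 0, so a bound on \<open>Lp_norm\<close>
  carries information only once membership in the space guarantees a finite extended norm.\<close>

lemma Lp_enorm_le_norm:
  assumes "f \<in> Lp_space M p" "Lp_norm M p f \<le> c"
  shows "Lp_enorm M p f \<le> ennreal c"
  using assms by (metis (no_types, lifting) Lp_space_def Lp_norm_def mem_Collect_eq
      infinity_ennreal_def ennreal_enn2real ennreal_leI)

lemma Lp_norm_le:
  assumes "0 \<le> c" "Lp_enorm M p f \<le> ennreal c"
  shows "Lp_norm M p f \<le> c"
  unfolding Lp_norm_def using enn2real_mono[OF assms(2)] assms(1) by simp

lemma Lp_norm_nonneg: "0 \<le> Lp_norm M p f"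
  by (simp add: Lp_norm_def)

text \<open>For finite exponent the integrals of the q-th powers are summable, so by monotone
  convergence the series of q-th powers is finite almost everywhere and its terms tend to 0. For the
  infinite exponent the geometric bounds hold off one common null set. The rate removes any passage
  to subsequences.\<close>

lemma AE_LIMSEQ_of_Lp_enorm_geometric:
  fixes f :: "nat \<Rightarrow> 't \<Rightarrow> 'a::{real_normed_vector, second_countable_topology}"
  assumes p: "1 \<le> p" and [measurable]: "\<And>n. f n \<in> borel_measurable M"
    and le: "\<And>n. Lp_enorm M p (f n) \<le> ennreal ((1/2) ^ n)"
  shows "AE t in M. (\<lambda>n. f n t) \<longlonglongrightarrow> 0"
proof (cases "p = \<infinity>")
  case True
  have "AE t in M. norm (f n t) \<le> (1/2) ^ n" for n
    using le[of n] Lp_enorm_infinity_le_iff[of "f n" M "(1/2) ^ n"] by (auto simp: True)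
  then have "AE t in M. \<forall>n. norm (f n t) \<le> (1/2) ^ n"
    by (simp add: AE_all_countable)
  then show ?thesis
  proof eventually_elim
    case (elim t)
    show ?case
      by (rule Lim_null_comparison[where g="\<lambda>n. (1/2::real) ^ n"])
        (use elim in \<open>auto intro!: LIMSEQ_realpow_zero\<close>)
  qed
next
  case False
  then have p': "p < \<infinity>" by (simp add: top.not_eq_extremum)
  define q where "q = enn2real p"
  have q: "q \<ge> 1"
    using one_le_enn2real[OF p p'] by (simp add: q_def)
  have le': "(\<integral>\<^sup>+ t. ennreal (norm (f n t) powr q) \<partial>M) \<le> ennreal ((1/2) ^ n)" for n
  proof -
    have "(\<integral>\<^sup>+ t. ennreal (norm (f n t) powr q) \<partial>M) \<le> ennreal (((1/2) ^ n) powr q)"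
      using le[of n] Lp_enorm_le_iff[OF p p', of "(1/2) ^ n" M "f n"] by (simp add: q_def)
    \<comment> \<open>A base of at most 1 decreases under a larger exponent, so the rate 1/2 serves
      for every q \<ge> 1.\<close>
    also have "\<dots> \<le> ennreal (((1/2) ^ n) powr 1)"
      using q by (intro ennreal_leI powr_mono') (auto simp: power_le_one)
    finally show ?thesis by simp
  qed
  have "(\<integral>\<^sup>+ t. (\<Sum>n. ennreal (norm (f n t) powr q)) \<partial>M)
      = (\<Sum>n. \<integral>\<^sup>+ t. ennreal (norm (f n t) powr q) \<partial>M)"
    by (intro nn_integral_suminf) measurable
  also have "\<dots> \<le> (\<Sum>n. ennreal ((1/2) ^ n))"
    by (intro suminf_le le') auto
  also have "\<dots> = ennreal (\<Sum>n. (1/2) ^ n)"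
    by (intro suminf_ennreal2) auto
  finally have "(\<integral>\<^sup>+ t. (\<Sum>n. ennreal (norm (f n t) powr q)) \<partial>M) \<noteq> \<infinity>"
    by (auto simp: top_unique)
  then have "AE t in M. (\<Sum>n. ennreal (norm (f n t) powr q)) \<noteq> \<infinity>"
    by (intro nn_integral_PInf_AE) measurable
  then show ?thesis
  proof eventually_elim
    case (elim t)
    then have "summable (\<lambda>n. norm (f n t) powr q)"
      by (intro summable_suminf_not_top) auto
    then have "(\<lambda>n. norm (f n t) powr q) \<longlonglongrightarrow> 0"
      by (rule summable_LIMSEQ_zero)
    then have "(\<lambda>n. (norm (f n t) powr q) powr (1 / q)) \<longlonglongrightarrow> 0 powr (1 / q)"
      using q by (intro tendsto_powr') auto
    then show ?case
      using q by (simp add: powr_powr tendsto_norm_zero_iff)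
  qed
qed

text \<open>Sigma-finiteness provides a positive function of finite integral. Scaled to integral at
  most 1 and capped at 1, it satisfies \<open>g powr q \<le> g\<close> for q \<ge> 1, so a single
  weight serves both exponents.\<close>

lemma (in sigma_finite_measure) ex_positive_Lp_weight:
  obtains g :: "'a \<Rightarrow> real" where "g \<in> borel_measurable M" "\<And>t. t \<in> space M \<Longrightarrow> 0 < g t"
    "\<And>p. 1 \<le> p \<Longrightarrow> Lp_enorm M p g \<le> 1"
proof -
  obtain h where h[measurable]: "h \<in> borel_measurable M" and hi: "integral\<^sup>N M h \<noteq> \<infinity>"
    and hp: "\<forall>x\<in>space M. 0 < h x \<and> h x < \<infinity>"
    using Ex_finite_integrable_function by blast
  define I where "I = enn2real (integral\<^sup>N M h)"
  have I: "integral\<^sup>N M h = ennreal I" "0 \<le> I"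
    using hi by (auto simp: I_def top.not_eq_extremum)
  \<comment> \<open>The denominator 1 + I rather than I keeps g positive when the integral I is
    0.\<close>
  define g where "g t = min 1 (enn2real (h t) / (1 + I))" for t
  have g0: "0 \<le> g t" "g t \<le> 1" for t
    using I by (auto simp: g_def)
  have [measurable]: "g \<in> borel_measurable M"
    unfolding g_def by measurable
  have pos: "0 < g t" if "t \<in> space M" for t
    using hp that I by (auto simp: g_def enn2real_positive_iff intro!: divide_pos_pos)
  have "(\<integral>\<^sup>+ t. ennreal (g t) \<partial>M) \<le> (\<integral>\<^sup>+ t. ennreal (1 / (1 + I)) * h t \<partial>M)"
  proof (rule nn_integral_mono)
    fix t assume "t \<in> space M"
    then have "h t = ennreal (enn2real (h t))"
      using hp by simp
    then have "ennreal (1 / (1 + I)) * h t = ennreal (enn2real (h t) / (1 + I))"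
      using I by (metis ennreal_mult' enn2real_nonneg mult.commute times_divide_eq_left mult_1)
    then show "ennreal (g t) \<le> ennreal (1 / (1 + I)) * h t"
      by (simp add: g_def ennreal_leI)
  qed
  also have "\<dots> = ennreal (I / (1 + I))"
    using I by (simp add: nn_integral_cmult ennreal_mult'[symmetric])
  also have "\<dots> \<le> ennreal 1"
    using I by (intro ennreal_leI) auto
  finally have int: "(\<integral>\<^sup>+ t. ennreal (g t) \<partial>M) \<le> 1" by simp
  have "Lp_enorm M p g \<le> 1" if p: "1 \<le> p" for p
  proof (cases "p = \<infinity>")
    case True
    then show ?thesis
      using Lp_enorm_infinity_le_iff[of g M 1] g0 by simp
  next
    case False
    then have p': "p < \<infinity>" by (simp add: top.not_eq_extremum)
    have q: "enn2real p \<ge> 1"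
      using one_le_enn2real[OF p p'] .
    have "norm (g t) powr enn2real p \<le> g t" for t
      using powr_mono'[OF q, of "g t"] g0[of t] by simp
    then have "(\<integral>\<^sup>+ t. ennreal (norm (g t) powr enn2real p) \<partial>M) \<le> (\<integral>\<^sup>+ t. ennreal (g t) \<partial>M)"
      by (intro nn_integral_mono ennreal_leI)
    then show ?thesis
      using int Lp_enorm_le_iff[OF p p', of 1 M g] by (simp add: order_trans)
  qed
  with pos show ?thesis by (intro that[of g]) auto
qed

section \<open>Measurable selections\<close>

text \<open>Measurability of S concerns fixed open sets, while the point w(t) moves. A countable
  dense set and rational radii decouple the two: the distance is below c iff some ball of radius
  \<rho> around a dense q contains w(t) and S(t) meets the ball of radius c - \<rho> around the same
  q.\<close>

lemma borel_measurable_infdist_multifunction: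
  fixes S :: "'t \<Rightarrow> 'w::{metric_space, second_countable_topology} set"
  assumes S: "measurable_closed_multifunction M S" and [measurable]: "w \<in> borel_measurable M"
  shows "(\<lambda>t. infdist (w t) (S t)) \<in> borel_measurable M"
proof (rule borel_measurableI_less)
  fix c
  obtain D :: "'w set" where D: "countable D" "\<And>X. open X \<Longrightarrow> X \<noteq> {} \<Longrightarrow> \<exists>d\<in>D. d \<in> X"
    using countable_dense_setE by blast
  have *: "infdist (w t) (S t) < c \<longleftrightarrow>
      (\<exists>q\<in>D. \<exists>\<rho>\<in>\<rat>. dist (w t) q < \<rho> \<and> S t \<inter> ball q (c - \<rho>) \<noteq> {})" if t: "t \<in> space M" for t
  proof
    assume "infdist (w t) (S t) < c"
    \<comment> \<open>Nonempty values exclude the default \<open>infdist\<close> value 0 for the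
      empty set.\<close>
    then obtain s where s: "s \<in> S t" "dist (w t) s < c"
      using S t by (force simp: measurable_closed_multifunction_def infdist_def cInf_less_iff)
    \<comment> \<open>With the gap d = c - dist (w t) s, the point q is within d/4 of w(t) and hence
      within c - 3d/4 of s; any \<rho> between d/4 and d/2 then meets both requirements.\<close>
    obtain q where q: "q \<in> D" "dist (w t) q < (c - dist (w t) s) / 4"
      using D(2)[of "ball (w t) ((c - dist (w t) s) / 4)"] s by auto
    obtain \<rho> where \<rho>: "\<rho> \<in> \<rat>" "(c - dist (w t) s) / 4 < \<rho>" "\<rho> < (c - dist (w t) s) / 2"
      using Rats_dense_in_real[of "(c - dist (w t) s) / 4" "(c - dist (w t) s) / 2"] s by auto
    have "dist q s < c - \<rho>"
      using dist_triangle[of q s "w t"] q \<rho> by (simp add: dist_commute)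
    then show "\<exists>q\<in>D. \<exists>\<rho>\<in>\<rat>. dist (w t) q < \<rho> \<and> S t \<inter> ball q (c - \<rho>) \<noteq> {}"
      using q \<rho> s by (intro bexI[of _ q] bexI[of _ \<rho>]) auto
  next
    assume "\<exists>q\<in>D. \<exists>\<rho>\<in>\<rat>. dist (w t) q < \<rho> \<and> S t \<inter> ball q (c - \<rho>) \<noteq> {}"
    then obtain q \<rho> s where "dist (w t) q < \<rho>" "s \<in> S t" "dist q s < c - \<rho>"
      by (auto simp: ball_def)
    then show "infdist (w t) (S t) < c"
      using infdist_le[of s "S t" "w t"] dist_triangle[of "w t" s q] by simp
  qed
  have "{t \<in> space M. infdist (w t) (S t) < c} =
    (\<Union>q\<in>D. \<Union>\<rho>\<in>\<rat>. {t \<in> space M. dist (w t) q < \<rho>} \<inter> {t \<in> space M. S t \<inter> ball q (c - \<rho>) \<noteq> {}})"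
    (is "?L = ?R")
  proof -
    have "?L = {t \<in> space M. \<exists>q\<in>D. \<exists>\<rho>\<in>\<rat>. dist (w t) q < \<rho> \<and> S t \<inter> ball q (c - \<rho>) \<noteq> {}}"
      using * by (intro Collect_cong conj_cong refl)
    also have "\<dots> = ?R"
      by (simp only: set_eq_iff UN_iff Int_iff mem_Collect_eq) blast
    finally show ?thesis .
  qed
  also have "\<dots> \<in> sets M"
  proof (rule sets.countable_UN''[OF D(1)], rule sets.countable_UN''[OF countable_rat])
    fix q \<rho>
    have "{t \<in> space M. S t \<inter> ball q (c - \<rho>) \<noteq> {}} \<in> sets M"
      using S unfolding measurable_closed_multifunction_def by blast
    moreover have "{t \<in> space M. dist (w t) q < \<rho>} \<in> sets M"
      by measurable
    ultimately show "{t \<in> space M. dist (w t) q < \<rho>} \<inter> {t \<in> space M. S t \<inter> ball q (c - \<rho>) \<noteq> {}} \<in> sets M"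
      by (rule sets.Int[rotated])
  qed
  finally show "{t \<in> space M. infdist (w t) (S t) < c} \<in> sets M" .
qed

text \<open>Some point of a dense sequence lies close to both w(t) and S(t). Taking the first such
  point makes the choice measurable, with countably many values; iterating the step halves the
  distance to S(t) each time.\<close>

lemma multifunction_approximation_step:
  fixes S :: "'t \<Rightarrow> 'w::{metric_space, second_countable_topology} set"
  assumes S: "measurable_closed_multifunction M S"
    and [measurable]: "w \<in> borel_measurable M" "g \<in> borel_measurable M"
    and lt: "\<And>t. t \<in> space M \<Longrightarrow> infdist (w t) (S t) < g t"
  obtains w' where "w' \<in> borel_measurable M"
    "\<And>t. t \<in> space M \<Longrightarrow> dist (w' t) (w t) < g t"
    "\<And>t. t \<in> space M \<Longrightarrow> infdist (w' t) (S t) < g t / 2"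
proof -
  obtain D :: "'w set" where D: "countable D" "\<And>X. open X \<Longrightarrow> X \<noteq> {} \<Longrightarrow> \<exists>d\<in>D. d \<in> X"
    using countable_dense_setE by blast
  have "D \<noteq> {}"
    using D(2)[of UNIV] by auto
  define q where "q = from_nat_into D"
  have q: "range q = D"
    using D(1) \<open>D \<noteq> {}\<close> by (simp add: q_def)
  have [measurable]: "(\<lambda>t. infdist (q k) (S t)) \<in> borel_measurable M" for k
    by (rule borel_measurable_infdist_multifunction[OF S]) simp
  define P where "P k t \<longleftrightarrow> dist (q k) (w t) < g t \<and> infdist (q k) (S t) < g t / 2" for k t
  have [measurable]: "Measurable.pred M (P k)" for k
    unfolding P_def by measurable
  have ex: "\<exists>k. P k t" if t: "t \<in> space M" for t
  proof -
    obtain s where s: "s \<in> S t" "dist (w t) s < g t"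
      using lt[OF t] S t by (force simp: measurable_closed_multifunction_def infdist_def cInf_less_iff)
    have "0 < g t"
      using s(2) by (rule le_less_trans[OF zero_le_dist])
    \<comment> \<open>A point within e of s meets both requirements: it stays within g(t) of w(t)
      and within g(t)/2 of S(t).\<close>
    define e where "e = min (g t - dist (w t) s) (g t / 2)"
    have "0 < e"
      using s \<open>0 < g t\<close> by (simp add: e_def)
    then obtain k where k: "dist s (q k) < e"
      using D(2)[of "ball s e"] q by auto
    have "dist (q k) (w t) < g t"
      using dist_triangle[of "q k" "w t" s] k by (simp add: e_def dist_commute)
    moreover have "infdist (q k) (S t) < g t / 2"
      using infdist_le[OF s(1), of "q k"] k by (simp add: e_def dist_commute)
    ultimately show ?thesis
      by (auto simp: P_def)
  qed
  have "P (LEAST k. P k t) t" if "t \<in> space M" for t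
    using ex[OF that] by (rule LeastI_ex)
  moreover have "(\<lambda>t. q (LEAST k. P k t)) \<in> borel_measurable M"
    by (rule measurable_compose[of "\<lambda>t. LEAST k. P k t" M "count_space UNIV"]) auto
  ultimately show ?thesis
    by (intro that[of "\<lambda>t. q (LEAST k. P k t)"]) (auto simp: P_def)
qed

text \<open>This is the construction behind the Kuratowski--Ryll-Nardzewski selection theorem,
  started at w. The approximations move by less than g(t)/2^n at step n, so they converge, the limit
  lies in the closed set S(t), and the total displacement is at most 2 g(t).\<close>

lemma measurable_near_selection:
  fixes S :: "'t \<Rightarrow> 'w::{complete_space, second_countable_topology} set"
  assumes S: "measurable_closed_multifunction M S"
    and w[measurable]: "w \<in> borel_measurable M" and [measurable]: "g \<in> borel_measurable M"
    and lt: "\<And>t. t \<in> space M \<Longrightarrow> infdist (w t) (S t) < g t"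
  obtains z where "z \<in> borel_measurable M" "\<And>t. t \<in> space M \<Longrightarrow> z t \<in> S t"
    "\<And>t. t \<in> space M \<Longrightarrow> dist (z t) (w t) \<le> 2 * g t"
proof -
  \<comment> \<open>The clause for n = 0 carries the starting point through dependent
    choice.\<close>
  have "\<exists>f. \<forall>n. (f n \<in> borel_measurable M \<and> (\<forall>t\<in>space M. infdist (f n t) (S t) < g t / 2 ^ n) \<and>
      (n = 0 \<longrightarrow> f n = w)) \<and> (\<forall>t\<in>space M. dist (f (Suc n) t) (f n t) < g t / 2 ^ n)"
  proof (rule dependent_nat_choice, goal_cases)
    case 1
    show ?case using lt by (intro exI[of _ w]) auto
  next
    case (2 v n)
    then have v: "v \<in> borel_measurable M" "\<And>t. t \<in> space M \<Longrightarrow> infdist (v t) (S t) < g t / 2 ^ n"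
      by auto
    obtain v' where "v' \<in> borel_measurable M"
      "\<And>t. t \<in> space M \<Longrightarrow> dist (v' t) (v t) < g t / 2 ^ n"
      "\<And>t. t \<in> space M \<Longrightarrow> infdist (v' t) (S t) < g t / 2 ^ n / 2"
      by (rule multifunction_approximation_step[OF S v(1) _ v(2)]) auto
    then show ?case
      by (intro exI[of _ v']) (auto simp: mult.commute)
  qed
  then obtain f where f: "\<And>n. f n \<in> borel_measurable M" "f 0 = w"
    "\<And>n t. t \<in> space M \<Longrightarrow> infdist (f n t) (S t) < g t / 2 ^ n"
    "\<And>n t. t \<in> space M \<Longrightarrow> dist (f (Suc n) t) (f n t) < g t / 2 ^ n"
    by metis
  have pos: "0 < g t" if "t \<in> space M" for t
    using lt[OF that] infdist_nonneg[of "w t" "S t"] by linarith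
  \<comment> \<open>The subtracted tail makes the induction close: one step costs g(t)/2^(m+k),
    exactly the amount by which the tail shrinks.\<close>
  have d: "dist (f (m + k) t) (f m t) \<le> 2 * g t / 2 ^ m - 2 * g t / 2 ^ (m + k)"
    if t: "t \<in> space M" for m k t
  proof (induction k)
    case (Suc k)
    have "dist (f (m + Suc k) t) (f m t)
        \<le> dist (f (Suc (m + k)) t) (f (m + k) t) + dist (f (m + k) t) (f m t)"
      by (simp add: dist_triangle)
    also have "\<dots> \<le> g t / 2 ^ (m + k) + (2 * g t / 2 ^ m - 2 * g t / 2 ^ (m + k))"
      using f(4)[OF t, of "m + k"] Suc by linarith
    finally show ?case by simp
  qed simp
  have d': "dist (f n t) (f m t) \<le> 2 * g t / 2 ^ m" if "t \<in> space M" "m \<le> n" for m n t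
    using d[OF that(1), of m "n - m"] pos[OF that(1)] that(2)
    by (smt (verit) le_add_diff_inverse zero_le_divide_iff zero_le_power)
  have lim0: "(\<lambda>n. c / 2 ^ n) \<longlonglongrightarrow> 0" for c :: real
    using tendsto_mult_left[OF LIMSEQ_realpow_zero[of "1/2::real"], of c] by (simp add: power_divide)
  have "convergent (\<lambda>n. f n t)" if t: "t \<in> space M" for t
  proof (rule Cauchy_convergent, rule metric_CauchyI)
    fix e :: real assume "0 < e"
    then have "eventually (\<lambda>n. 2 * g t / 2 ^ n < e / 2) sequentially"
      using order_tendstoD(2)[OF lim0, of "e / 2" "2 * g t"] by simp
    then obtain N where N: "2 * g t / 2 ^ N < e / 2"
      by (auto simp: eventually_sequentially)
    show "\<exists>M. \<forall>m\<ge>M. \<forall>n\<ge>M. dist (f m t) (f n t) < e"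
    proof (intro exI allI impI)
      fix m n assume "N \<le> m" "N \<le> n"
      then show "dist (f m t) (f n t) < e"
        using d'[OF t, of N m] d'[OF t, of N n] N dist_triangle2[of "f m t" "f n t" "f N t"] by simp
    qed
  qed
  then have lim: "(\<lambda>n. f n t) \<longlonglongrightarrow> lim (\<lambda>n. f n t)" if "t \<in> space M" for t
    using that convergent_LIMSEQ_iff by blast
  show ?thesis
  proof (rule that[of "\<lambda>t. lim (\<lambda>n. f n t)"])
    show "(\<lambda>t. lim (\<lambda>n. f n t)) \<in> borel_measurable M"
      by (rule borel_measurable_LIMSEQ_metric[OF f(1) lim])
  next
    fix t assume t: "t \<in> space M"
    have "(\<lambda>n. infdist (f n t) (S t)) \<longlonglongrightarrow> 0"
      by (rule tendsto_sandwich[OF _ _ tendsto_const lim0[of "g t"]])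
        (use f(3)[OF t] in \<open>auto simp: infdist_nonneg less_imp_le\<close>)
    then have "infdist (lim (\<lambda>n. f n t)) (S t) = 0"
      using LIMSEQ_unique tendsto_infdist[OF lim[OF t]] by blast
    then show "lim (\<lambda>n. f n t) \<in> S t"
      using S t by (simp add: measurable_closed_multifunction_def in_closed_iff_infdist_zero)
    show "dist (lim (\<lambda>n. f n t)) (w t) \<le> 2 * g t"
      using d'[OF t, of 0] f(2)
      by (intro LIMSEQ_le_const2[OF tendsto_dist[OF lim[OF t] tendsto_const]]) auto
  qed
qed

section \<open>Tangent sets\<close>

lemma norm_le_sum_norm: "norm w \<le> sum_norm w"
  by (cases w) (simp add: sum_norm_def norm_Pair_le)

lemma sum_norm_le_norm: "sum_norm w \<le> 2 * norm w"
  using norm_fst_le[of "fst w" "snd w"] norm_snd_le[of "snd w" "fst w"]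
  by (simp add: sum_norm_def split_beta)

lemma sum_norm_scaleR: "sum_norm (c *\<^sub>R w) = \<bar>c\<bar> * sum_norm w"
  by (simp add: sum_norm_def split_beta algebra_simps)

text \<open>Along a sequence the radii \<delta> and \<tau> of the definition are absorbed into
  "eventually". What remains mentions only the distance to C, which is measurable in t when applied
  to C = S(t).\<close>

lemma uniform_tangent_set_eventually_infdist:
  assumes ut: "uniform_tangent_set UNIV sum_norm C x D" and "0 < e"
    and u: "u \<longlonglongrightarrow> x" "\<And>n. u n \<in> C" and v: "\<And>n. v n \<in> D"
    and \<eta>: "\<eta> \<longlonglongrightarrow> 0" "\<And>n. 0 < \<eta> n"
  shows "\<forall>\<^sub>F n in sequentially. infdist (u n + \<eta> n *\<^sub>R v n) C < \<eta> n * e"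
proof -
  \<comment> \<open>Tangency is applied with e/2, since it yields only a non-strict bound.\<close>
  have "0 < e / 2"
    using \<open>0 < e\<close> by simp
  obtain \<delta> \<tau> where pos: "0 < \<delta>" "0 < \<tau>" and
    *: "\<forall>v\<in>D. \<forall>y\<in>C \<inter> (\<lambda>b. x + \<delta> *\<^sub>R b) ` unit_cball UNIV sum_norm. \<forall>\<eta>\<in>{0..\<tau>}.
      C \<inter> (\<lambda>b. y + \<eta> *\<^sub>R (v + (e / 2) *\<^sub>R b)) ` unit_cball UNIV sum_norm \<noteq> {}"
    using ut[unfolded uniform_tangent_set_def, THEN conjunct2, THEN conjunct2, THEN conjunct2, rule_format,
        OF \<open>0 < e / 2\<close>]
    by (elim exE conjE) (rule that)
  have "\<forall>\<^sub>F n in sequentially. dist (u n) x < \<delta> / 2"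
    using tendstoD[OF u(1), of "\<delta> / 2"] pos by simp
  moreover have "\<forall>\<^sub>F n in sequentially. \<eta> n < \<tau>"
    using order_tendstoD(2)[OF \<eta>(1) pos(2)] .
  ultimately show ?thesis
  proof eventually_elim
    case (elim n)
    \<comment> \<open>The radius \<delta>/2 for the library norm compensates the factor 2 in
      \<open>sum_norm_le_norm\<close>.\<close>
    have "sum_norm ((1 / \<delta>) *\<^sub>R (u n - x)) \<le> 1"
      using sum_norm_le_norm[of "u n - x"] elim pos
      by (simp add: sum_norm_scaleR dist_norm divide_simps)
    then have "u n \<in> (\<lambda>b. x + \<delta> *\<^sub>R b) ` unit_cball UNIV sum_norm"
      using pos by (intro image_eqI[where x="(1 / \<delta>) *\<^sub>R (u n - x)"]) (auto simp: unit_cball_def)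
    then obtain b where b: "u n + \<eta> n *\<^sub>R (v n + (e / 2) *\<^sub>R b) \<in> C" "sum_norm b \<le> 1"
      using *[rule_format, of "v n" "u n" "\<eta> n"] u(2)[of n] v[of n] elim(2) \<eta>(2)[of n]
      by (auto simp: unit_cball_def)
    have "infdist (u n + \<eta> n *\<^sub>R v n) C \<le> norm ((\<eta> n * (e / 2)) *\<^sub>R b)"
      using infdist_le[OF b(1), of "u n + \<eta> n *\<^sub>R v n"]
      by (simp add: dist_norm algebra_simps)
    also have "\<dots> \<le> \<eta> n * (e / 2) * 1"
      using norm_le_sum_norm[of b] b(2) \<eta>(2)[of n] \<open>0 < e\<close> unfolding norm_scaleR
      by (intro mult_mono) auto
    also have "\<dots> < \<eta> n * e"
      using \<eta>(2)[of n] \<open>0 < e\<close> by simp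
    finally show ?case .
  qed
qed

text \<open>Approximating selections chosen at a geometric rate converge almost everywhere, and
  closedness of the values passes membership to the limit.\<close>

lemma norm_closed_Sel:
  assumes p: "1 \<le> p" and r: "1 \<le> r" and closed: "AE t in M. closed (S t)"
  shows "norm_closed (LpLr_space M p r) (LpLr_norm M p r) (Sel M p r S)"
  unfolding norm_closed_def
proof (intro conjI ballI impI)
  show "Sel M p r S \<subseteq> LpLr_space M p r"
    by (auto simp: Sel_def)
  fix z assume z: "z \<in> LpLr_space M p r"
    and approx: "\<forall>e>0. \<exists>c\<in>Sel M p r S. LpLr_norm M p r (z - c) < e"
  have "\<exists>c\<in>Sel M p r S. LpLr_norm M p r (z - c) < (1/2) ^ n" for n
    using approx by simp
  then obtain c where c: "\<And>n. c n \<in> Sel M p r S" "\<And>n. LpLr_norm M p r (z - c n) < (1/2) ^ n"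
    by metis
  have cX: "fst (c n) \<in> Lp_space M p" "snd (c n) \<in> Lp_space M r" for n
    using c(1)[of n] by (auto simp: Sel_def LpLr_space_def)
  have zX: "fst z \<in> Lp_space M p" "snd z \<in> Lp_space M r"
    using z by (auto simp: LpLr_space_def)
  have le: "Lp_norm M p (\<lambda>t. fst z t - fst (c n) t) + Lp_norm M r (\<lambda>t. snd z t - snd (c n) t) \<le> (1/2) ^ n"
    for n
    using c(2)[of n] by (simp add: LpLr_norm_def split_beta fun_diff_def)
  have "AE t in M. (\<lambda>n. fst z t - fst (c n) t) \<longlonglongrightarrow> 0"
  proof (rule AE_LIMSEQ_of_Lp_enorm_geometric[OF p])
    show "(\<lambda>t. fst z t - fst (c n) t) \<in> borel_measurable M" for n
      by (rule Lp_space_measurable[OF Lp_space_diff[OF p zX(1) cX(1)]])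
    show "Lp_enorm M p (\<lambda>t. fst z t - fst (c n) t) \<le> ennreal ((1/2) ^ n)" for n
      using le[of n] Lp_norm_nonneg[of M r "\<lambda>t. snd z t - snd (c n) t"]
      by (intro Lp_enorm_le_norm[OF Lp_space_diff[OF p zX(1) cX(1)]]) linarith
  qed
  moreover have "AE t in M. (\<lambda>n. snd z t - snd (c n) t) \<longlonglongrightarrow> 0"
  proof (rule AE_LIMSEQ_of_Lp_enorm_geometric[OF r])
    show "(\<lambda>t. snd z t - snd (c n) t) \<in> borel_measurable M" for n
      by (rule Lp_space_measurable[OF Lp_space_diff[OF r zX(2) cX(2)]])
    show "Lp_enorm M r (\<lambda>t. snd z t - snd (c n) t) \<le> ennreal ((1/2) ^ n)" for n
      using le[of n] Lp_norm_nonneg[of M p "\<lambda>t. fst z t - fst (c n) t"]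
      by (intro Lp_enorm_le_norm[OF Lp_space_diff[OF r zX(2) cX(2)]]) linarith
  qed
  moreover have "AE t in M. \<forall>n. (fst (c n) t, snd (c n) t) \<in> S t"
    using c(1) by (auto simp: AE_all_countable Sel_def split_beta)
  ultimately have "AE t in M. (fst z t, snd z t) \<in> S t"
    using closed
  proof eventually_elim
    case (elim t)
    have "(\<lambda>n. (fst (c n) t, snd (c n) t)) \<longlonglongrightarrow> (fst z t, snd z t)"
      using tendsto_diff[OF tendsto_const[of "fst z t"] elim(1)]
        tendsto_diff[OF tendsto_const[of "snd z t"] elim(2)]
      by (intro tendsto_Pair) auto
    then show ?case
      by (rule closed_sequentially[OF elim(4), rotated]) (use elim(3) in blast)
  qed
  then show "z \<in> Sel M p r S"
    using z by (auto simp: Sel_def split_beta)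
qed

text \<open>On B the glued function is dominated by w restricted to A, off B by a multiple of the
  weight. After division by \<epsilon> each part has norm at most 1/16, and the constant 4 of
  \<open>Lp_enorm_le_sum\<close> gives 1/4, small enough for two components to fit in the unit
  ball.\<close>

lemma Lp_enorm_glued_le:
  assumes q: "1 \<le> q" and [measurable]: "A \<in> sets M" "B \<in> sets M" and "B \<subseteq> A" and "0 < \<epsilon>"
    and w: "w \<in> Lp_space M q" "Lp_norm M q (\<lambda>t. indicator A t *\<^sub>R w t) \<le> \<epsilon> / 16"
    and [measurable]: "e \<in> borel_measurable M" "g \<in> borel_measurable M"
    and g: "Lp_enorm M q g \<le> 1"
    and e: "\<And>t. t \<in> space M - B \<Longrightarrow> norm (e t) \<le> \<epsilon> / 16 * g t"
  shows "Lp_enorm M q (\<lambda>t. (1 / \<epsilon>) *\<^sub>R (if t \<in> B then w t else e t)) \<le> ennreal (1 / 4)"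
proof -
  note [measurable] = Lp_space_measurable[OF w(1)]
  obtain c where c: "0 \<le> c" "Lp_enorm M q w \<le> ennreal c"
    using Lp_space_bound[OF w(1)] .
  \<comment> \<open>Finiteness comes first, so that the assumed bound on the real-valued norm can be
    turned into one on the extended norm.\<close>
  have "Lp_enorm M q (\<lambda>t. indicator A t *\<^sub>R w t) \<le> ennreal c"
    by (rule Lp_enorm_mono[OF _ q c(1) _ _ c(2)]) (auto simp: indicator_def)
  then have "(\<lambda>t. indicator A t *\<^sub>R w t) \<in> Lp_space M q"
    by (rule Lp_spaceI[rotated]) measurable
  then have "Lp_enorm M q (\<lambda>t. indicator A t *\<^sub>R w t) \<le> ennreal (\<epsilon> / 16)"
    using w(2) by (rule Lp_enorm_le_norm)
  then have "Lp_enorm M q (\<lambda>t. (1 / \<epsilon>) *\<^sub>R (indicator A t *\<^sub>R w t)) \<le> ennreal (\<bar>1 / \<epsilon>\<bar> * (\<epsilon> / 16))"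
    using q \<open>0 < \<epsilon>\<close> by (intro Lp_enorm_scaleR) auto
  then have 1: "Lp_enorm M q (\<lambda>t. (1 / \<epsilon>) *\<^sub>R (indicator A t *\<^sub>R w t)) \<le> ennreal (1 / 16)"
    using \<open>0 < \<epsilon>\<close> by simp
  have 2: "Lp_enorm M q (\<lambda>t. (1 / 16) *\<^sub>R g t) \<le> ennreal (1 / 16)"
    using Lp_enorm_scaleR[of g M q 1 "1/16"] q g by simp
  have "AE t in M. norm ((1 / \<epsilon>) *\<^sub>R (if t \<in> B then w t else e t))
      \<le> norm ((1 / \<epsilon>) *\<^sub>R (indicator A t *\<^sub>R w t)) + norm ((1 / 16) *\<^sub>R g t)"
  proof (rule AE_I2)
    fix t assume t: "t \<in> space M"
    show "norm ((1 / \<epsilon>) *\<^sub>R (if t \<in> B then w t else e t))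
      \<le> norm ((1 / \<epsilon>) *\<^sub>R (indicator A t *\<^sub>R w t)) + norm ((1 / 16) *\<^sub>R g t)"
    proof (cases "t \<in> B")
      case True
      then show ?thesis using \<open>B \<subseteq> A\<close> by (auto simp: indicator_def)
    next
      case False
      have "norm ((1 / \<epsilon>) *\<^sub>R e t) = (1 / \<epsilon>) * norm (e t)"
        using \<open>0 < \<epsilon>\<close> by simp
      also have "\<dots> \<le> (1 / \<epsilon>) * (\<epsilon> / 16 * g t)"
        using e[of t] t False \<open>0 < \<epsilon>\<close> by (intro mult_left_mono) auto
      also have "\<dots> \<le> norm ((1 / 16) *\<^sub>R g t)"
        using \<open>0 < \<epsilon>\<close> by simp
      finally show ?thesis using False by (simp add: add_increasing)
    qed
  qed
  then have "Lp_enorm M q (\<lambda>t. (1 / \<epsilon>) *\<^sub>R (if t \<in> B then w t else e t)) \<le> ennreal (4 * (1 / 16))"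
    by (intro Lp_enorm_le_sum[OF q _ _ _ _ _ 1 2]) auto
  then show ?thesis by simp
qed

section \<open>Rescaled unit balls and the gluing argument\<close>

lemma Lp_norm_scaleR_le:
  assumes "1 \<le> p" "f \<in> Lp_space M p"
  shows "Lp_norm M p (\<lambda>t. k *\<^sub>R f t) \<le> \<bar>k\<bar> * Lp_norm M p f"
proof (rule Lp_norm_le)
  show "Lp_enorm M p (\<lambda>t. k *\<^sub>R f t) \<le> ennreal (\<bar>k\<bar> * Lp_norm M p f)"
    by (rule Lp_enorm_scaleR[OF Lp_space_measurable[OF assms(2)] assms(1) Lp_norm_nonneg
          Lp_enorm_le_norm[OF assms(2) order_refl]])
qed (simp add: Lp_norm_nonneg)

text \<open>Balls are written as scaled images of the unit ball, so enlarging a radius amounts to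
  shrinking the unit-ball element.\<close>

lemma LpLr_unit_cball_scaleR:
  assumes p: "1 \<le> p" and r: "1 \<le> r" and b: "b \<in> unit_cball (LpLr_space M p r) (LpLr_norm M p r)"
    and k: "\<bar>k\<bar> \<le> 1"
  shows "k *\<^sub>R b \<in> unit_cball (LpLr_space M p r) (LpLr_norm M p r)"
proof -
  obtain b1 b2 where [simp]: "b = (b1, b2)" by (cases b)
  have X: "b1 \<in> Lp_space M p" "b2 \<in> Lp_space M r"
    and le: "Lp_norm M p b1 + Lp_norm M r b2 \<le> 1"
    using b by (auto simp: unit_cball_def LpLr_space_def LpLr_norm_def)
  have "Lp_norm M p (\<lambda>t. k *\<^sub>R b1 t) + Lp_norm M r (\<lambda>t. k *\<^sub>R b2 t)
      \<le> \<bar>k\<bar> * (Lp_norm M p b1 + Lp_norm M r b2)"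
    using Lp_norm_scaleR_le[OF p X(1), of k] Lp_norm_scaleR_le[OF r X(2), of k]
    by (simp add: distrib_left)
  also have "\<dots> \<le> 1 * 1"
    using k le by (intro mult_mono) (auto simp: Lp_norm_nonneg)
  finally show ?thesis
    using Lp_space_scaleR[OF p X(1), of k] Lp_space_scaleR[OF r X(2), of k]
    by (auto simp: unit_cball_def LpLr_space_def LpLr_norm_def scaleR_fun_def)
qed

text \<open>Equi-integrability makes all corrections small on a tail set \<open>A n\<close> of bad
  points, and a single such n suffices. There the corrected selection is used on \<open>B n\<close>
  and a near selection of S elsewhere.\<close>

lemma Sel_tangent_sequence:
  fixes M :: "'t measure"
    and S D :: "'t \<Rightarrow> ('y::{banach, second_countable_topology} \<times>
                      'z::{banach, second_countable_topology}) set"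
  assumes \<sigma>: "sigma_finite_measure M" and p: "1 \<le> p" and r: "1 \<le> r"
    and S: "measurable_closed_multifunction M S"
    and tangent: "AE t in M. uniform_tangent_set UNIV sum_norm (S t) (x t, y t) (D t)"
    and R: "equi_integrable M p r R"
    and u: "\<And>n. u n \<in> Sel M p r S" and v: "\<And>n. v n \<in> Sel M p r D"
    and \<eta>: "\<eta> \<longlonglongrightarrow> 0" "\<And>n. 0 < \<eta> n"
    and lim: "AE t in M. (\<lambda>n. (fst (u n) t, snd (u n) t)) \<longlonglongrightarrow> (x t, y t)"
    and corr: "\<And>n. \<exists>w\<in>R. u n + \<eta> n *\<^sub>R v n + \<eta> n *\<^sub>R w \<in> Sel M p r S"
    and \<epsilon>: "0 < \<epsilon>"
  shows "\<exists>n. Sel M p r S \<inter> (\<lambda>b. u n + \<eta> n *\<^sub>R (v n + \<epsilon> *\<^sub>R b)) `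
    unit_cball (LpLr_space M p r) (LpLr_norm M p r) \<noteq> {}"
proof -
  obtain g :: "'t \<Rightarrow> real" where g[measurable]: "g \<in> borel_measurable M"
    and g0: "\<And>t. t \<in> space M \<Longrightarrow> 0 < g t"
    and g1: "\<And>p. 1 \<le> p \<Longrightarrow> Lp_enorm M p g \<le> 1"
    using sigma_finite_measure.ex_positive_Lp_weight[OF \<sigma>] by metis
  have uX: "fst (u n) \<in> Lp_space M p" "snd (u n) \<in> Lp_space M r"
    and vX: "fst (v n) \<in> Lp_space M p" "snd (v n) \<in> Lp_space M r" for n
    using u[of n] v[of n] by (auto simp: Sel_def LpLr_space_def)
  note [measurable] = uX[THEN Lp_space_measurable] vX[THEN Lp_space_measurable]
  define W where "W n t = (fst (u n) t, snd (u n) t) + \<eta> n *\<^sub>R (fst (v n) t, snd (v n) t)" for n t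
  have W[measurable]: "W n \<in> borel_measurable M" for n
    unfolding W_def by measurable
  have dW[measurable]: "(\<lambda>t. infdist (W n t) (S t)) \<in> borel_measurable M" for n
    by (rule borel_measurable_infdist_multifunction[OF S W])
  \<comment> \<open>Off \<open>B n\<close> the near selection is within 2 * (\<eta>\<gamma> +
    \<eta>\<gamma>) = 4\<eta>\<gamma> of \<open>W n\<close>; the constant 64 turns this into \<eta>
    * \<epsilon>/16 * g, as the gluing estimate requires.\<close>
  define \<gamma> where "\<gamma> t = \<epsilon> / 64 * g t" for t
  have [measurable]: "\<gamma> \<in> borel_measurable M"
    unfolding \<gamma>_def by measurable
  have \<gamma>0: "0 < \<gamma> t" if "t \<in> space M" for t
    using g0[OF that] \<epsilon> by (simp add: \<gamma>_def)
  define B where "B n = {t \<in> space M. \<not> infdist (W n t) (S t) < \<eta> n * \<gamma> t}" for n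
  have B[measurable]: "B n \<in> sets M" for n
    unfolding B_def by measurable
  have uS: "AE t in M. \<forall>n. (fst (u n) t, snd (u n) t) \<in> S t"
    using u by (auto simp: AE_all_countable Sel_def split_beta)
  have vD: "AE t in M. \<forall>n. (fst (v n) t, snd (v n) t) \<in> D t"
    using v by (auto simp: AE_all_countable Sel_def split_beta)
  have good: "AE t in M. \<forall>\<^sub>F n in sequentially. t \<notin> B n"
    using tangent lim uS vD AE_space
  proof eventually_elim
    \<comment> \<open>For fixed t the tolerance is \<open>\<gamma> t\<close>, which is positive and
      does not vary with n.\<close>
    case (elim t)
    have "\<forall>\<^sub>F n in sequentially. infdist (W n t) (S t) < \<eta> n * \<gamma> t"
      unfolding W_def
      by (rule uniform_tangent_set_eventually_infdist[OF elim(1) \<gamma>0[OF elim(5)] elim(2) _ _ \<eta>])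
        (use elim in auto)
    then show ?case
      by eventually_elim (simp add: B_def)
  qed
  define A where "A n = (\<Union>m\<in>{n..}. B m)" for n
  have A[measurable]: "A n \<in> sets M" for n
    unfolding A_def by (intro sets.countable_UN'') auto
  have "AE t in M. t \<notin> (\<Inter>n. A n)"
    using good by eventually_elim (auto simp: A_def eventually_sequentially)
  moreover have "(\<Inter>n. A n) \<in> sets M"
    using A by (intro sets.countable_INT) auto
  ultimately have "(\<Inter>n. A n) \<in> null_sets M"
    by (simp add: AE_iff_null_sets)
  moreover have "decseq A"
    by (force simp: decseq_def A_def)
  ultimately have "(\<lambda>n. SUP (a, b)\<in>R. ennreal (LpLr_norm M p r
      (\<lambda>t. indicator (A n) t *\<^sub>R a t, \<lambda>t. indicator (A n) t *\<^sub>R b t))) \<longlonglongrightarrow> 0"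
    using R[unfolded equi_integrable_def] A by blast
  then have "\<forall>\<^sub>F n in sequentially. (SUP (a, b)\<in>R. ennreal (LpLr_norm M p r
      (\<lambda>t. indicator (A n) t *\<^sub>R a t, \<lambda>t. indicator (A n) t *\<^sub>R b t))) < ennreal (\<epsilon> / 16)"
    using \<epsilon> by (intro order_tendstoD) auto
  then obtain n where n: "(SUP (a, b)\<in>R. ennreal (LpLr_norm M p r
      (\<lambda>t. indicator (A n) t *\<^sub>R a t, \<lambda>t. indicator (A n) t *\<^sub>R b t))) < ennreal (\<epsilon> / 16)"
    by (auto simp: eventually_sequentially)
  \<comment> \<open>The correction may change with n; uniformity of the supremum over
    \<open>R\<close> controls it on \<open>A n\<close>.\<close>
  obtain a b where ab: "(a, b) \<in> R" and h: "u n + \<eta> n *\<^sub>R v n + \<eta> n *\<^sub>R (a, b) \<in> Sel M p r S"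
    using corr[of n] by auto
  have abX: "a \<in> Lp_space M p" "b \<in> Lp_space M r"
    using R ab by (auto simp: equi_integrable_def LpLr_space_def)
  have "ennreal (LpLr_norm M p r (\<lambda>t. indicator (A n) t *\<^sub>R a t, \<lambda>t. indicator (A n) t *\<^sub>R b t))
      \<le> ennreal (\<epsilon> / 16)"
    by (rule order_trans[OF _ less_imp_le[OF n]]) (rule SUP_upper2[OF ab], simp)
  then have ab_le: "Lp_norm M p (\<lambda>t. indicator (A n) t *\<^sub>R a t)
      + Lp_norm M r (\<lambda>t. indicator (A n) t *\<^sub>R b t) \<le> \<epsilon> / 16"
    using \<epsilon> by (simp add: LpLr_norm_def)
  have \<eta>n: "0 < \<eta> n" by (rule \<eta>)
  \<comment> \<open>The near selection needs a strict bound on the whole space, including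
    \<open>B n\<close>, where the distance itself may be large; adding it to the tolerance provides
    one.\<close>
  have lt: "infdist (W n t) (S t) < infdist (W n t) (S t) + \<eta> n * \<gamma> t" if "t \<in> space M" for t
    using \<gamma>0[OF that] \<eta>n by simp
  obtain z where z[measurable]: "z \<in> borel_measurable M" and zS: "\<And>t. t \<in> space M \<Longrightarrow> z t \<in> S t"
    and zW: "\<And>t. t \<in> space M \<Longrightarrow> dist (z t) (W n t) \<le> 2 * (infdist (W n t) (S t) + \<eta> n * \<gamma> t)"
    by (rule measurable_near_selection[OF S W _ lt]) auto
  define e where "e t = (1 / \<eta> n) *\<^sub>R (z t - W n t)" for t
  have [measurable]: "e \<in> borel_measurable M"
    unfolding e_def by measurable
  have fst_e[measurable]: "(\<lambda>t. fst (e t)) \<in> borel_measurable M"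
    by (rule measurable_compose[of e M borel]) (auto intro!: borel_measurable_continuous_onI continuous_intros)
  have snd_e[measurable]: "(\<lambda>t. snd (e t)) \<in> borel_measurable M"
    by (rule measurable_compose[of e M borel]) (auto intro!: borel_measurable_continuous_onI continuous_intros)
  have e_le: "norm (e t) \<le> \<epsilon> / 16 * g t" if t: "t \<in> space M - B n" for t
  proof -
    have "dist (z t) (W n t) \<le> 4 * (\<eta> n * \<gamma> t)"
      using zW[of t] t by (auto simp: B_def)
    then have "dist (z t) (W n t) / \<eta> n \<le> 4 * (\<eta> n * \<gamma> t) / \<eta> n"
      using \<eta>n by (intro divide_right_mono) auto
    then show ?thesis
      using \<eta>n by (simp add: e_def \<gamma>_def dist_norm)
  qed
  have fst_le: "norm (fst (e t)) \<le> \<epsilon> / 16 * g t" and snd_le: "norm (snd (e t)) \<le> \<epsilon> / 16 * g t"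
    if "t \<in> space M - B n" for t
    using e_le[OF that] norm_fst_le[of "fst (e t)" "snd (e t)"] norm_snd_le[of "snd (e t)" "fst (e t)"]
    by auto
  have BA: "B n \<subseteq> A n"
    by (auto simp: A_def)
  \<comment> \<open>The choice makes u + \<eta> (v + \<epsilon> b) equal to the corrected selection
    on \<open>B n\<close> and to the near selection z off it.\<close>
  define b1 where "b1 t = (1 / \<epsilon>) *\<^sub>R (if t \<in> B n then a t else fst (e t))" for t
  define b2 where "b2 t = (1 / \<epsilon>) *\<^sub>R (if t \<in> B n then b t else snd (e t))" for t
  note [measurable] = abX[THEN Lp_space_measurable]
  have [measurable]: "b1 \<in> borel_measurable M" "b2 \<in> borel_measurable M"
    unfolding b1_def b2_def by measurable
  have b1: "Lp_enorm M p b1 \<le> ennreal (1 / 4)"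
    unfolding b1_def using Lp_norm_nonneg[of M r "\<lambda>t. indicator (A n) t *\<^sub>R b t"] ab_le
    by (intro Lp_enorm_glued_le[OF p A B BA \<epsilon> abX(1) _ fst_e g g1[OF p] fst_le]) auto
  have b2: "Lp_enorm M r b2 \<le> ennreal (1 / 4)"
    unfolding b2_def using Lp_norm_nonneg[of M p "\<lambda>t. indicator (A n) t *\<^sub>R a t"] ab_le
    by (intro Lp_enorm_glued_le[OF r A B BA \<epsilon> abX(2) _ snd_e g g1[OF r] snd_le]) auto
  have bX: "b1 \<in> Lp_space M p" "b2 \<in> Lp_space M r"
    by (rule Lp_spaceI[OF _ b1] Lp_spaceI[OF _ b2], measurable)+
  have ball: "(b1, b2) \<in> unit_cball (LpLr_space M p r) (LpLr_norm M p r)"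
    using bX Lp_norm_le[OF _ b1] Lp_norm_le[OF _ b2]
    by (simp add: unit_cball_def LpLr_space_def LpLr_norm_def)
  define c where "c = u n + \<eta> n *\<^sub>R (v n + \<epsilon> *\<^sub>R (b1, b2))"
  have fst_c: "fst c = (\<lambda>t. fst (u n) t + \<eta> n *\<^sub>R (fst (v n) t + \<epsilon> *\<^sub>R b1 t))"
    and snd_c: "snd c = (\<lambda>t. snd (u n) t + \<eta> n *\<^sub>R (snd (v n) t + \<epsilon> *\<^sub>R b2 t))"
    by (auto simp: c_def fun_eq_iff)
  have "c \<in> LpLr_space M p r"
    unfolding LpLr_space_def mem_Times_iff fst_c snd_c
    by (intro conjI Lp_space_add Lp_space_scaleR p r uX vX bX)
  moreover have "AE t in M. (fst c t, snd c t) \<in> S t"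
  proof -
    have "AE t in M. (fst (u n) t + \<eta> n *\<^sub>R fst (v n) t + \<eta> n *\<^sub>R a t,
        snd (u n) t + \<eta> n *\<^sub>R snd (v n) t + \<eta> n *\<^sub>R b t) \<in> S t"
      using h by (simp add: Sel_def split_beta)
    with AE_space show ?thesis
    proof eventually_elim
      case (elim t)
      show ?case
      proof (cases "t \<in> B n")
        case True
        then show ?thesis
          using elim(2) \<epsilon> by (simp add: fst_c snd_c b1_def b2_def algebra_simps)
      next
        case False
        have "\<eta> n *\<^sub>R e t = z t - W n t"
          using \<eta>n by (simp add: e_def)
        then have "z t = (fst c t, snd c t)"
          using False \<epsilon>
          by (simp add: fst_c snd_c b1_def b2_def W_def prod_eq_iff algebra_simps)
        then show ?thesis
          using zS[OF elim(1)] by simp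
      qed
    qed
  qed
  ultimately have "c \<in> Sel M p r S"
    by (auto simp: Sel_def split_beta)
  with ball show ?thesis
    unfolding c_def by blast
qed

section \<open>Choice of a violating sequence and the contradiction\<close>

theorem theorem2:
  fixes M :: "'t measure"
    and p r :: ennreal
    and S D :: "'t \<Rightarrow> ('y::{banach, second_countable_topology} \<times>
                      'z::{banach, second_countable_topology}) set"
    and x :: "'t \<Rightarrow> 'y" and y :: "'t \<Rightarrow> 'z"
  assumes "complete_measure M" and "sigma_finite_measure M"
    and "1 \<le> p" and "1 \<le> r" and "p < \<infinity> \<or> r < \<infinity>"
    and "measurable_closed_multifunction M S"
    and "(x, y) \<in> Sel M p r S"
    and "measurable_closed_multifunction M D"
    and "AE t in M. uniform_tangent_set UNIV sum_norm (S t) (x t, y t) (D t)"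
    and "\<exists>R. equi_integrable M p r R \<and>
           correctable_along (LpLr_space M p r) (LpLr_norm M p r)
             (Sel M p r S) (Sel M p r D) R (x, y)"
  shows "uniform_tangent_set (LpLr_space M p r) (LpLr_norm M p r)
           (Sel M p r S) (x, y) (Sel M p r D)"
  unfolding uniform_tangent_set_def
proof (intro conjI allI impI)
  note p = \<open>1 \<le> p\<close> and r = \<open>1 \<le> r\<close>
  let ?ball = "unit_cball (LpLr_space M p r) (LpLr_norm M p r)"
  show "norm_closed (LpLr_space M p r) (LpLr_norm M p r) (Sel M p r S)"
    by (rule norm_closed_Sel[OF p r])
      (use assms(6) in \<open>auto simp: measurable_closed_multifunction_def\<close>)
  show "(x, y) \<in> Sel M p r S" by fact
  show "Sel M p r D \<subseteq> LpLr_space M p r"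
    by (auto simp: Sel_def)
  fix \<epsilon> :: real assume \<epsilon>: "0 < \<epsilon>"
  obtain R where R: "equi_integrable M p r R" and
    along: "correctable_along (LpLr_space M p r) (LpLr_norm M p r) (Sel M p r S) (Sel M p r D) R (x, y)"
    using assms(10) by (elim exE conjE)
  obtain \<delta>0 \<tau>0 where pos: "0 < \<delta>0" "0 < \<tau>0" and
    corr: "\<forall>\<eta>\<in>{0..\<tau>0}.
      {h + \<eta> *\<^sub>R v |h v. h \<in> Sel M p r S \<inter> (\<lambda>b. (x, y) + \<delta>0 *\<^sub>R b) ` ?ball \<and> v \<in> Sel M p r D}
        \<subseteq> {h - \<eta> *\<^sub>R w |h w. h \<in> Sel M p r S \<and> w \<in> R}"
    using along[unfolded correctable_along_def] by (elim exE conjE) (rule that)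
  show "\<exists>\<delta>>0. \<exists>\<tau>>0. \<forall>v\<in>Sel M p r D. \<forall>u\<in>Sel M p r S \<inter> (\<lambda>b. (x, y) + \<delta> *\<^sub>R b) ` ?ball.
      \<forall>\<eta>\<in>{0..\<tau>}. Sel M p r S \<inter> (\<lambda>b. u + \<eta> *\<^sub>R (v + \<epsilon> *\<^sub>R b)) ` ?ball \<noteq> {}"
  proof (rule ccontr)
    assume contra: "\<not> ?thesis"
    \<comment> \<open>The caps \<delta>0 and \<tau>0 keep every base point and step within the range
      of correctability.\<close>
    define m where "m = min 1 (min \<delta>0 \<tau>0)"
    have m: "0 < m" "m \<le> 1" "m \<le> \<delta>0" "m \<le> \<tau>0"
      using pos by (auto simp: m_def)
    \<comment> \<open>The number \<open>s n\<close> plays both \<delta> and \<tau> in the negated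
      tangency; its geometric decay gives almost everywhere convergence.\<close>
    define s where "s n = (1/2) ^ n * m" for n :: nat
    have s: "0 < s n" "s n \<le> (1/2) ^ n" "s n \<le> m" for n
      using m by (auto simp: s_def mult_le_cancel_left1 mult_le_cancel_right1 power_le_one)
    have "\<exists>v b \<eta>. v \<in> Sel M p r D \<and> b \<in> ?ball \<and> (x, y) + s n *\<^sub>R b \<in> Sel M p r S \<and> \<eta> \<in> {0..s n} \<and>
        Sel M p r S \<inter> (\<lambda>b'. ((x, y) + s n *\<^sub>R b) + \<eta> *\<^sub>R (v + \<epsilon> *\<^sub>R b')) ` ?ball = {}" for n
    proof -
      have "\<not> (\<forall>v\<in>Sel M p r D. \<forall>u\<in>Sel M p r S \<inter> (\<lambda>b. (x, y) + s n *\<^sub>R b) ` ?ball.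
          \<forall>\<eta>\<in>{0..s n}. Sel M p r S \<inter> (\<lambda>b. u + \<eta> *\<^sub>R (v + \<epsilon> *\<^sub>R b)) ` ?ball \<noteq> {})"
      proof
        assume *: "\<forall>v\<in>Sel M p r D. \<forall>u\<in>Sel M p r S \<inter> (\<lambda>b. (x, y) + s n *\<^sub>R b) ` ?ball.
          \<forall>\<eta>\<in>{0..s n}. Sel M p r S \<inter> (\<lambda>b. u + \<eta> *\<^sub>R (v + \<epsilon> *\<^sub>R b)) ` ?ball \<noteq> {}"
        show False
          by (rule notE[OF contra]) (intro exI[of _ "s n"] conjI s(1) *)
      qed
      then obtain v u \<eta> where *: "v \<in> Sel M p r D"
        "u \<in> Sel M p r S \<inter> (\<lambda>b. (x, y) + s n *\<^sub>R b) ` ?ball" "\<eta> \<in> {0..s n}"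
        "Sel M p r S \<inter> (\<lambda>b. u + \<eta> *\<^sub>R (v + \<epsilon> *\<^sub>R b)) ` ?ball = {}"
        unfolding Ball_def not_all not_imp not_not by (elim exE conjE) (rule that)
      from *(2) obtain b where "b \<in> ?ball" "u = (x, y) + s n *\<^sub>R b" "u \<in> Sel M p r S"
        by (elim IntE imageE)
      with * show ?thesis
        by (intro exI[of _ v] exI[of _ b] exI[of _ \<eta>]) simp
    qed
    then obtain v b \<eta> where v: "\<And>n. v n \<in> Sel M p r D" and b: "\<And>n. b n \<in> ?ball"
      and u: "\<And>n. (x, y) + s n *\<^sub>R b n \<in> Sel M p r S" and \<eta>: "\<And>n. \<eta> n \<in> {0..s n}"
      and empty: "\<And>n. Sel M p r S \<inter>
        (\<lambda>b'. ((x, y) + s n *\<^sub>R b n) + \<eta> n *\<^sub>R (v n + \<epsilon> *\<^sub>R b')) ` ?ball = {}"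
      by metis
    define u where "u n = (x, y) + s n *\<^sub>R b n" for n
    \<comment> \<open>For a zero step the translated ball collapses to the base point, which is
      itself a selection of S, against emptiness of the intersection.\<close>
    have \<eta>pos: "0 < \<eta> n" for n
    proof (rule ccontr)
      assume "\<not> 0 < \<eta> n"
      then have "\<eta> n = 0" using \<eta>[of n] by auto
      then show False using empty[of n] u[of n] b[of n] by auto
    qed
    have lim0: "(\<lambda>n. (1/2::real) ^ n) \<longlonglongrightarrow> 0"
      by (rule LIMSEQ_realpow_zero) auto
    have "0 \<le> \<eta> n" "\<eta> n \<le> (1/2) ^ n" for n
      using \<eta>[of n] s(2)[of n] by auto
    then have \<eta>lim: "\<eta> \<longlonglongrightarrow> 0"
      by (intro tendsto_sandwich[OF _ _ tendsto_const lim0]) auto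
    have bX: "fst (b n) \<in> Lp_space M p" "snd (b n) \<in> Lp_space M r"
      and b_le: "Lp_norm M p (fst (b n)) + Lp_norm M r (snd (b n)) \<le> 1" for n
      using b[of n] by (auto simp: unit_cball_def LpLr_space_def LpLr_norm_def)
    note [measurable] = bX[THEN Lp_space_measurable]
    have b1: "Lp_norm M p (fst (b n)) \<le> 1" and b2: "Lp_norm M r (snd (b n)) \<le> 1" for n
      using b_le[of n] Lp_norm_nonneg[of M p "fst (b n)"] Lp_norm_nonneg[of M r "snd (b n)"]
      by linarith+
    have "AE t in M. (\<lambda>n. s n *\<^sub>R fst (b n) t) \<longlonglongrightarrow> 0"
    proof (rule AE_LIMSEQ_of_Lp_enorm_geometric[OF p])
      fix n
      have "Lp_enorm M p (\<lambda>t. s n *\<^sub>R fst (b n) t) \<le> ennreal (\<bar>s n\<bar> * 1)"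
        by (rule Lp_enorm_scaleR[OF Lp_space_measurable[OF bX(1)] p _ Lp_enorm_le_norm[OF bX(1) b1]]) simp
      also have "\<dots> \<le> ennreal ((1/2) ^ n)"
        using s[of n] by (intro ennreal_leI) auto
      finally show "Lp_enorm M p (\<lambda>t. s n *\<^sub>R fst (b n) t) \<le> ennreal ((1/2) ^ n)" .
    qed measurable
    moreover have "AE t in M. (\<lambda>n. s n *\<^sub>R snd (b n) t) \<longlonglongrightarrow> 0"
    proof (rule AE_LIMSEQ_of_Lp_enorm_geometric[OF r])
      fix n
      have "Lp_enorm M r (\<lambda>t. s n *\<^sub>R snd (b n) t) \<le> ennreal (\<bar>s n\<bar> * 1)"
        by (rule Lp_enorm_scaleR[OF Lp_space_measurable[OF bX(2)] r _ Lp_enorm_le_norm[OF bX(2) b2]]) simp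
      also have "\<dots> \<le> ennreal ((1/2) ^ n)"
        using s[of n] by (intro ennreal_leI) auto
      finally show "Lp_enorm M r (\<lambda>t. s n *\<^sub>R snd (b n) t) \<le> ennreal ((1/2) ^ n)" .
    qed measurable
    ultimately have lim: "AE t in M. (\<lambda>n. (fst (u n) t, snd (u n) t)) \<longlonglongrightarrow> (x t, y t)"
    proof eventually_elim
      case (elim t)
      show ?case
        using tendsto_add[OF tendsto_const[of "x t"] elim(1)] tendsto_add[OF tendsto_const[of "y t"] elim(2)]
        by (intro tendsto_Pair) (auto simp: u_def)
    qed
    have "\<exists>w\<in>R. u n + \<eta> n *\<^sub>R v n + \<eta> n *\<^sub>R w \<in> Sel M p r S" for n
    proof -
      \<comment> \<open>A point within \<open>s n\<close> of (x, y) is re-expressed as one within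
        \<delta>0, as \<delta>0 is the radius in the correctability condition.\<close>
      have "(s n / \<delta>0) *\<^sub>R b n \<in> ?ball"
        using s[of n] m pos by (intro LpLr_unit_cball_scaleR p r b) auto
      then have "u n \<in> (\<lambda>b. (x, y) + \<delta>0 *\<^sub>R b) ` ?ball"
        using pos by (intro image_eqI[where x="(s n / \<delta>0) *\<^sub>R b n"]) (auto simp: u_def)
      moreover have "\<eta> n \<in> {0..\<tau>0}"
        using \<eta>[of n] s(3)[of n] m by auto
      ultimately have "u n + \<eta> n *\<^sub>R v n \<in> {h - \<eta> n *\<^sub>R w |h w. h \<in> Sel M p r S \<and> w \<in> R}"
        using u[of n] v[of n] unfolding u_def by (intro subsetD[OF corr[rule_format]]) blast+
      \<comment> \<open>Moving \<eta> w to the left turns the subtracted correction into the added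
        one used in the gluing.\<close>
      then obtain h w where "u n + \<eta> n *\<^sub>R v n = h - \<eta> n *\<^sub>R w" "h \<in> Sel M p r S" "w \<in> R"
        by blast
      then show ?thesis by (intro bexI[of _ w]) simp_all
    qed
    then show False
      using Sel_tangent_sequence[OF assms(2) p r assms(6,9) R, of u v \<eta> \<epsilon>]
        u v \<eta>lim \<eta>pos lim \<epsilon> empty
      unfolding u_def by blast
  qed
qed

end
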